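(* For every analytic P-ideal $\mathcal{I}$ on $\omega$ generated by an unbounded submeasure, $$\mathrm{non}(\mathcal{I}\text{QN-space})=\mathrm{non}(\mathcal{I}\text{wQN-space})=\mathfrak{b}.$$
   Context: An ideal on $\omega$ is a proper subfamily of $\mathcal{P}(\omega)$ closed under finite unions and subsets and containing all finite sets. It is a P-ideal if for every $\{A_n:n\in\omega\}\subseteq\mathcal I$ there is $A\in\mathcal I$ with $A_n\setminus A$ finite for all $n$. "Analytic" refers to the topology on $\mathcal P(\omega)\cong 2^\omega$. A lower semicontinuous submeasure on $\omega$ is a map $\phi:\mathcal P(\omega)\to[0,\infty]$ with $\phi(\emptyset)=0$, $\phi(A)\le\phi(A\cup B)\le\phi(A)+\phi(B)$, $\phi(\{n\})<\infty$ for all $n\in\omega$, and $\phi(A)=\lim_{n}\phi(A\cap\{0,\dots,n\})$ for all $A$. $\mathrm{Exh}(\phi)=\{A\subseteq\omega:\lim_n\phi(A\cap\{n,n+1,\dots\})=0\}$. An analytic P-ideal $\mathcal I$ is generated by an unbounded submeasure if $\mathcal I=\mathrm{Exh}(\phi)$ for some lower semicontinuous submeasure $\phi$ with $\phi(\omega)=\infty$. A sequence of reals $(x_n)$ is $\mathcal I$-convergent to $x$ if $\{n:|x_n-x|\ge\varepsilon\}\in\mathcal I$ for all $\varepsilon>0$. A sequence $(f_n)\subseteq\mathbb R^X$ $\mathcal I$QN-converges to $f\in\mathbb R^X$ if there are positive reals $\varepsilon_n$, with $(\varepsilon_n)$ $\mathcal I$-convergent to $0$, such that $\{n:|f_n(x)-f(x)|\ge\varepsilon_n\}\in\mathcal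 I$ for each $x\in X$. For infinite $B\subseteq\omega$, $e_B:\omega\to B$ is its increasing enumeration. A topological space $X$ is an $\mathcal I$QN-space if every sequence of continuous functions $f_n:X\to\mathbb R$ converging pointwise to $0$ $\mathcal I$QN-converges to $0$; it is an $\mathcal I$wQN-space if for every such sequence there is an infinite $B\subseteq\omega$ such that $(f_{e_B(n)})_n$ $\mathcal I$QN-converges to $0$. $\mathrm{non}(\mathcal I\text{QN-space})$ (resp. $\mathrm{non}(\mathcal I\text{wQN-space})$) is the minimal cardinality of a perfectly normal topological space which is not an $\mathcal I$QN-space (resp. not an $\mathcal I$wQN-space). $\mathfrak b$ is the bounding number. *)

theory Defs
  imports "HOL-Analysis.Analysis" "HOL-Library.Infinite_Set"
begin

unbundle cardinal_syntax

section \<open>Ideals on the natural numbers\<close>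

definition ideal_on_omega :: "nat set set \<Rightarrow> bool" where
  "ideal_on_omega \<I> \<longleftrightarrow>
     \<I> \<noteq> UNIV \<and>
     (\<forall>A\<in>\<I>. \<forall>B\<in>\<I>. A \<union> B \<in> \<I>) \<and>
     (\<forall>A\<in>\<I>. \<forall>B. B \<subseteq> A \<longrightarrow> B \<in> \<I>) \<and>
     (\<forall>A. finite A \<longrightarrow> A \<in> \<I>)"

definition P_ideal :: "nat set set \<Rightarrow> bool" where
  "P_ideal \<I> \<longleftrightarrow>
     ideal_on_omega \<I> \<and>
     (\<forall>A :: nat \<Rightarrow> nat set. range A \<subseteq> \<I> \<longrightarrow> (\<exists>B\<in>\<I>. \<forall>n. finite (A n - B)))"

text \<open>
  Analytic sets are the continuous images of the Baire space, together with the empty set.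
  The types \<^typ>\<open>nat \<Rightarrow> nat\<close> and \<^typ>\<open>nat \<Rightarrow> bool\<close> carry the product topology of the discrete
  topologies on \<^typ>\<open>nat\<close> and \<^typ>\<open>bool\<close>; a family of sets is identified with the set of
  characteristic functions of its members.
\<close>

definition analytic_family :: "nat set set \<Rightarrow> bool" where
  "analytic_family \<A> \<longleftrightarrow>
     \<A> = {} \<or>
     (\<exists>f :: (nat \<Rightarrow> nat) \<Rightarrow> (nat \<Rightarrow> bool).
        continuous_on UNIV f \<and> range f = (\<lambda>A n. n \<in> A) ` \<A>)"

definition lsc_submeasure :: "(nat set \<Rightarrow> ennreal) \<Rightarrow> bool" where
  "lsc_submeasure \<phi> \<longleftrightarrow>
     \<phi> {} = 0 \<and>
     (\<forall>A B. \<phi> A \<le> \<phi> (A \<union> B) \<and> \<phi> (A \<union> B) \<le> \<phi> A + \<phi> B) \<and>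
     (\<forall>n. \<phi> {n} < \<infinity>) \<and>
     (\<forall>A. (\<lambda>n. \<phi> (A \<inter> {0..n})) \<longlonglongrightarrow> \<phi> A)"

definition Exh :: "(nat set \<Rightarrow> ennreal) \<Rightarrow> nat set set" where
  "Exh \<phi> = {A. (\<lambda>n. \<phi> (A \<inter> {n..})) \<longlonglongrightarrow> 0}"

definition generated_by_unbounded_submeasure :: "nat set set \<Rightarrow> bool" where
  "generated_by_unbounded_submeasure \<I> \<longleftrightarrow>
     (\<exists>\<phi>. lsc_submeasure \<phi> \<and> \<phi> UNIV = \<infinity> \<and> \<I> = Exh \<phi>)"

section \<open>Ideal convergence and ideal QN-spaces\<close>

definition I_convergent :: "nat set set \<Rightarrow> (nat \<Rightarrow> real) \<Rightarrow> real \<Rightarrow> bool" where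
  "I_convergent \<I> x l \<longleftrightarrow> (\<forall>\<epsilon>>0. {n. \<bar>x n - l\<bar> \<ge> \<epsilon>} \<in> \<I>)"

definition IQN_convergent_on ::
  "nat set set \<Rightarrow> 'a set \<Rightarrow> (nat \<Rightarrow> 'a \<Rightarrow> real) \<Rightarrow> ('a \<Rightarrow> real) \<Rightarrow> bool" where
  "IQN_convergent_on \<I> S f g \<longleftrightarrow>
     (\<exists>\<epsilon> :: nat \<Rightarrow> real. (\<forall>n. \<epsilon> n > 0) \<and> I_convergent \<I> \<epsilon> 0 \<and>
        (\<forall>x\<in>S. {n. \<bar>f n x - g x\<bar> \<ge> \<epsilon> n} \<in> \<I>))"

definition continuous_null_sequence :: "'a topology \<Rightarrow> (nat \<Rightarrow> 'a \<Rightarrow> real) \<Rightarrow> bool" where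
  "continuous_null_sequence X f \<longleftrightarrow>
     (\<forall>n. continuous_map X euclideanreal (f n)) \<and>
     (\<forall>x\<in>topspace X. (\<lambda>n. f n x) \<longlonglongrightarrow> 0)"

definition IQN_space :: "nat set set \<Rightarrow> 'a topology \<Rightarrow> bool" where
  "IQN_space \<I> X \<longleftrightarrow>
     (\<forall>f. continuous_null_sequence X f \<longrightarrow>
        IQN_convergent_on \<I> (topspace X) f (\<lambda>x. 0))"

definition IwQN_space :: "nat set set \<Rightarrow> 'a topology \<Rightarrow> bool" where
  "IwQN_space \<I> X \<longleftrightarrow>
     (\<forall>f. continuous_null_sequence X f \<longrightarrow>
        (\<exists>B :: nat set. infinite B \<and>
           IQN_convergent_on \<I> (topspace X) (\<lambda>n. f (enumerate B n)) (\<lambda>x. 0)))"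

text \<open>As usual in general topology, perfectly normal spaces are assumed to be \<open>T\<^sub>1\<close>, which
  \<^const>\<open>normal_space\<close> alone does not include.\<close>

definition perfectly_normal_space :: "'a topology \<Rightarrow> bool" where
  "perfectly_normal_space X \<longleftrightarrow>
     t1_space X \<and> normal_space X \<and> (\<forall>C. closedin X C \<longrightarrow> gdelta_in X C)"

section \<open>Cardinal invariants\<close>

text \<open>
  The least cardinality of a member of a class of sets. For the empty class, where no minimum
  exists, the value is the cardinal 0; hence an equation between \<open>least_card\<close> of a class and a
  nonzero cardinal asserts in particular that the class is nonempty.
\<close>

definition least_card :: "'a set set \<Rightarrow> 'a rel" where
  "least_card \<A> =
     (if \<A> = {} then |{}| else |SOME A. A \<in> \<A> \<and> (\<forall>B\<in>\<A>. |A| \<le>o |B| )| )"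

lemma least_card_attained_and_least:
  assumes "\<A> \<noteq> {}"
  shows "(\<exists>A\<in>\<A>. least_card \<A> = |A| ) \<and> (\<forall>B\<in>\<A>. least_card \<A> \<le>o |B| )"
proof -
  have "\<exists>r\<in>card_of ` \<A>. \<forall>r'\<in>card_of ` \<A>. r \<le>o r'"
    using assms by (intro exists_minim_Card_order) (auto simp: card_of_Card_order)
  then have "\<exists>A. A \<in> \<A> \<and> (\<forall>B\<in>\<A>. |A| \<le>o |B| )"
    by auto
  from someI_ex[OF this] show ?thesis
    using assms by (auto simp: least_card_def)
qed

text \<open>
  The points of the spaces are taken from an arbitrary type \<^typ>\<open>'a\<close>, which plays the role of a
  universe; only for types with enough elements is this the minimum over all spaces.
\<close>

definition non_IQN_space :: "nat set set \<Rightarrow> 'a rel" where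
  "non_IQN_space \<I> =
     least_card {topspace X | X :: 'a topology. perfectly_normal_space X \<and> \<not> IQN_space \<I> X}"

definition non_IwQN_space :: "nat set set \<Rightarrow> 'a rel" where
  "non_IwQN_space \<I> =
     least_card {topspace X | X :: 'a topology. perfectly_normal_space X \<and> \<not> IwQN_space \<I> X}"

definition unbounded_family :: "(nat \<Rightarrow> nat) set \<Rightarrow> bool" where
  "unbounded_family F \<longleftrightarrow> \<not> (\<exists>g. \<forall>f\<in>F. \<forall>\<^sub>F n in sequentially. f n \<le> g n)"

definition bounding_number :: "(nat \<Rightarrow> nat) rel" where
  "bounding_number = least_card {F. unbounded_family F}"

end

theory Submission
  imports Defs
begin

text \<open>
  A function \<open>g :: nat \<Rightarrow> nat\<close> is coded by a null sequence, its \<open>staircase\<close>, which stays above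
  \<open>1 / (k + 1)\<close> up to \<open>g k\<close>. If the moduli of convergence of a pointwise null sequence are
  eventually dominated by \<open>g\<close>, the staircase of \<open>g\<close> is a control sequence, so fewer than
  \<open>\<bb>\<close> points never violate QN-convergence. Conversely, put the discrete topology on an unbounded
  family \<open>F\<close> of size \<open>\<bb>\<close> and let the \<open>n\<close>-th function map \<open>f\<close> to the \<open>n\<close>-th value of its staircase.
  Given an \<open>\<I>\<close>-null control sequence \<open>\<epsilon>\<close>, each set \<open>{n. \<epsilon> n < 1 / (k + 1)}\<close> has infinite
  submeasure, so a finite piece of it beyond \<open>k\<close>, bounded by some \<open>G k\<close>, has submeasure at least 1.
  Control of \<open>f\<close> along \<open>B\<close> then forces \<open>f k \<le> e\<^sub>B (G k)\<close> for almost all \<open>k\<close>, so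
  control of all of \<open>F\<close> would bound \<open>F\<close>.
\<close>

section \<open>Staircases as null sequences\<close>

text \<open>The summand \<open>k\<close> makes \<open>k = n\<close> a solution, so the
  \<open>LEAST\<close> exists for every \<open>n\<close>, even if \<open>g\<close> is bounded. An
  index \<open>k\<close> can serve only the finitely many \<open>n \<le> g k + k\<close>, which is
  why the values tend to 0.\<close>

definition staircase :: "(nat \<Rightarrow> nat) \<Rightarrow> nat \<Rightarrow> real" where
  "staircase g n = inverse (real (Suc (LEAST k. n \<le> g k + k)))"

lemma staircase_pos: "staircase g n > 0"
  by (simp add: staircase_def)

lemma staircase_ge:
  assumes "n \<le> g k"
  shows "inverse (real (Suc k)) \<le> staircase g n"
proof -
  have "(LEAST k. n \<le> g k + k) \<le> k"
    using assms by (intro Least_le) simp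
  then show ?thesis
    by (simp add: staircase_def)
qed

lemma filterlim_staircase_index:
  fixes g :: "nat \<Rightarrow> nat"
  shows "filterlim (\<lambda>n. LEAST k. n \<le> g k + k) at_top sequentially"
  unfolding filterlim_at_top
proof
  fix K
  have "\<forall>\<^sub>F n in sequentially. \<forall>k\<in>{..<K}. g k + k < n"
    by (intro eventually_ball_finite) (auto intro: eventually_gt_at_top)
  then show "\<forall>\<^sub>F n in sequentially. K \<le> (LEAST k. n \<le> g k + k)"
  proof eventually_elim
    case (elim n)
    define L where "L = (LEAST k. n \<le> g k + k)"
    have "n \<le> g L + L"
      unfolding L_def by (rule LeastI[of _ n]) simp
    with elim have "\<not> L < K"
      by (meson lessThan_iff not_less)
    then show ?case
      by (simp add: L_def)
  qed
qed

lemma staircase_tendsto_0: "staircase g \<longlonglongrightarrow> 0"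
  unfolding staircase_def
  by (rule filterlim_compose[OF LIMSEQ_inverse_real_of_nat filterlim_staircase_index])

lemma eventually_less_staircase:
  fixes u :: "nat \<Rightarrow> real"
  assumes modulus: "\<And>k n. h k \<le> n \<Longrightarrow> \<bar>u n\<bar> < inverse (real (k + 2))"
    and dominated: "\<forall>\<^sub>F k in sequentially. h k \<le> g k"
  shows "\<forall>\<^sub>F n in sequentially. \<bar>u n\<bar> < staircase g n"
proof -
  obtain k0 where k0: "\<And>k. k \<ge> k0 \<Longrightarrow> h k \<le> g k"
    using dominated by (auto simp: eventually_sequentially)
  have "\<forall>\<^sub>F n in sequentially. Suc k0 \<le> (LEAST k. n \<le> g k + k)"
    using filterlim_staircase_index by (auto simp: filterlim_at_top)
  then show ?thesis
  proof eventually_elim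
    case (elim n)
    then obtain j where j: "(LEAST k. n \<le> g k + k) = Suc j" "k0 \<le> j"
      by (cases "LEAST k. n \<le> g k + k") auto
    \<comment> \<open>Minimality of \<open>Suc j\<close> speaks only about its predecessor
      \<open>j\<close>. The staircase has value \<open>1 / (j + 2)\<close> here, which explains the
      \<open>k + 2\<close> in the modulus.\<close>
    then have "\<not> n \<le> g j + j"
      using not_less_Least[of j "\<lambda>k. n \<le> g k + k"] by simp
    then have "h j \<le> n"
      using k0[OF j(2)] by linarith
    from modulus[OF this] show ?case
      using j(1) by (simp add: staircase_def)
  qed
qed

section \<open>Ideal convergence\<close>

lemma ideal_mem_if_eventually_not:
  assumes "ideal_on_omega \<I>" "\<forall>\<^sub>F n in sequentially. \<not> P n"
  shows "{n. P n} \<in> \<I>"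
  using assms unfolding ideal_on_omega_def
  by (simp add: eventually_cofinite flip: cofinite_eq_sequentially)

lemma tendsto_imp_I_convergent:
  assumes "ideal_on_omega \<I>" "x \<longlonglongrightarrow> l"
  shows "I_convergent \<I> x l"
  unfolding I_convergent_def
proof (intro allI impI)
  fix e :: real assume "e > 0"
  with assms(2) have "\<forall>\<^sub>F n in sequentially. \<bar>x n - l\<bar> < e"
    by (auto simp: tendsto_iff dist_real_def)
  then show "{n. \<bar>x n - l\<bar> \<ge> e} \<in> \<I>"
    by (intro ideal_mem_if_eventually_not[OF assms(1)]) (simp add: not_le)
qed

text \<open>Take \<open>B = UNIV\<close>, whose enumeration is the identity.\<close>

lemma IQN_space_imp_IwQN_space:
  assumes "IQN_space \<I> X"
  shows "IwQN_space \<I> X"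
proof -
  have "enumerate UNIV n = n" for n :: nat
    by (induction n) (auto simp: enumerate_Suc'' enumerate_0 intro!: Least_equality)
  then show ?thesis
    using assms unfolding IQN_space_def IwQN_space_def
    by (auto intro!: exI[of _ "UNIV :: nat set"])
qed

section \<open>The bounding number and least cardinals\<close>

text \<open>Ensures that \<open>bounding_number\<close> is an attained minimum and not the default
  value of \<open>least_card\<close>.\<close>

lemma unbounded_family_UNIV: "unbounded_family UNIV"
proof -
  have "\<exists>f. \<not> (\<forall>\<^sub>F n in sequentially. f n \<le> g n)" for g :: "nat \<Rightarrow> nat"
    by (intro exI[of _ "\<lambda>n. Suc (g n)"]) simp
  then show ?thesis
    by (auto simp: unbounded_family_def)
qed

lemma bounding_number_le:
  assumes "unbounded_family F"
  shows "bounding_number \<le>o |F|"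
  using assms least_card_attained_and_least[of "{F. unbounded_family F}"]
  by (auto simp: bounding_number_def)

lemma bounding_number_attained:
  obtains F where "unbounded_family F" "bounding_number = |F|"
  using least_card_attained_and_least[of "{F. unbounded_family F}"] unbounded_family_UNIV
  by (auto simp: bounding_number_def)

lemma least_card_eqI:
  fixes r :: "'b rel"
  assumes "A \<in> \<A>" "|A| =o r" "\<And>B. B \<in> \<A> \<Longrightarrow> r \<le>o |B|"
  shows "least_card \<A> =o r"
proof -
  have "least_card \<A> \<le>o |A|" and "\<exists>B\<in>\<A>. least_card \<A> = |B|"
    using least_card_attained_and_least[of \<A>] assms(1) by auto
  then have "least_card \<A> \<le>o r" "r \<le>o least_card \<A>"
    using assms(2,3) ordLeq_ordIso_trans by auto
  then show ?thesis
    by (simp add: ordIso_iff_ordLeq)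
qed

section \<open>The lower bound\<close>

text \<open>Assign to each point \<open>x\<close> a modulus of convergence \<open>h x\<close> of the
  sequence witnessing the failure. A common eventual bound \<open>g\<close> of these moduli would
  make \<open>staircase g\<close> a control, so they form an unbounded family, which is an image of
  the space.\<close>

lemma bounding_number_le_not_IQN_space:
  assumes ideal: "ideal_on_omega \<I>" and not_IQN: "\<not> IQN_space \<I> X"
  shows "bounding_number \<le>o |topspace X|"
proof -
  obtain f where f: "continuous_null_sequence X f"
    and not_conv: "\<not> IQN_convergent_on \<I> (topspace X) f (\<lambda>x. 0)"
    using not_IQN by (auto simp: IQN_space_def)
  have "\<exists>N. \<forall>n\<ge>N. \<bar>f n x\<bar> < inverse (real (k + 2))" if "x \<in> topspace X" for x k
  proof -
    have "(\<lambda>n. f n x) \<longlonglongrightarrow> 0"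
      using f that by (simp add: continuous_null_sequence_def)
    then show ?thesis
      by (force dest: LIMSEQ_D[where r = "inverse (real (k + 2))"])
  qed
  then obtain h where h:
    "\<And>x k n. x \<in> topspace X \<Longrightarrow> h x k \<le> n \<Longrightarrow> \<bar>f n x\<bar> < inverse (real (k + 2))"
    by metis
  have "unbounded_family (h ` topspace X)"
  proof (rule ccontr)
    assume "\<not> unbounded_family (h ` topspace X)"
    then obtain g where g: "\<And>x. x \<in> topspace X \<Longrightarrow> \<forall>\<^sub>F k in sequentially. h x k \<le> g k"
      by (auto simp: unbounded_family_def)
    have "{n. \<bar>f n x - 0\<bar> \<ge> staircase g n} \<in> \<I>" if "x \<in> topspace X" for x
      using eventually_less_staircase[of "h x" "\<lambda>n. f n x", OF h[OF that] g[OF that]]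
      by (intro ideal_mem_if_eventually_not[OF ideal]) (simp add: not_le)
    then have "IQN_convergent_on \<I> (topspace X) f (\<lambda>x. 0)"
      unfolding IQN_convergent_on_def
      using staircase_pos tendsto_imp_I_convergent[OF ideal staircase_tendsto_0] by blast
    with not_conv show False ..
  qed
  then show ?thesis
    using bounding_number_le card_of_image ordLeq_transitive by blast
qed

section \<open>Unbounded submeasures and the upper bound\<close>

lemma lsc_submeasure_mono: "lsc_submeasure \<phi> \<Longrightarrow> A \<subseteq> B \<Longrightarrow> \<phi> A \<le> \<phi> B"
  unfolding lsc_submeasure_def by (metis Un_absorb1)

lemma lsc_submeasure_Un: "lsc_submeasure \<phi> \<Longrightarrow> \<phi> (A \<union> B) \<le> \<phi> A + \<phi> B"
  unfolding lsc_submeasure_def by blast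

lemma lsc_submeasure_finite:
  assumes "lsc_submeasure \<phi>" "finite A"
  shows "\<phi> A < \<infinity>"
  using assms(2)
proof induction
  case empty
  show ?case using assms(1) by (simp add: lsc_submeasure_def)
next
  case (insert x A)
  have "\<phi> (insert x A) \<le> \<phi> {x} + \<phi> A"
    using lsc_submeasure_Un[OF assms(1), of "{x}" A] by simp
  also have "\<dots> < \<infinity>"
    using insert.IH assms(1) by (simp add: lsc_submeasure_def)
  finally show ?case .
qed

lemma Exh_eventually_less:
  assumes "A \<in> Exh \<phi>" "e > 0"
  shows "\<forall>\<^sub>F n in sequentially. \<phi> (A \<inter> {n..}) < e"
  using assms by (auto simp: Exh_def dest: order_tendstoD(2))

text \<open>Removing \<open>A\<close> costs only a finite amount: some tail of \<open>A\<close> has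
  submeasure below 1, and what precedes that tail is finite. By subadditivity
  \<open>{m..} - A\<close> keeps infinite submeasure, and lower semicontinuity passes to a finite
  piece.\<close>

lemma unbounded_submeasure_diff_Exh:
  assumes \<phi>: "lsc_submeasure \<phi>" "\<phi> UNIV = \<infinity>" and A: "A \<in> Exh \<phi>"
  shows "\<exists>M. \<phi> ({m..<M} - A) \<ge> 1"
proof -
  \<comment> \<open>Taking \<open>p\<close> at least \<open>m\<close> lets \<open>{..<p}\<close>
    absorb everything below \<open>m\<close> as well.\<close>
  obtain p where p: "m \<le> p" "\<phi> (A \<inter> {p..}) < 1"
    using eventually_conj[OF eventually_ge_at_top[of m] Exh_eventually_less[OF A, of 1]]
    by (auto simp: eventually_sequentially)
  have "UNIV = ({..<p} \<union> (A \<inter> {p..})) \<union> ({m..} - A)"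
    using p(1) by auto
  then have "\<phi> UNIV \<le> \<phi> ({..<p} \<union> (A \<inter> {p..})) + \<phi> ({m..} - A)"
    by (metis lsc_submeasure_Un[OF \<phi>(1)])
  also have "\<dots> \<le> (\<phi> {..<p} + \<phi> (A \<inter> {p..})) + \<phi> ({m..} - A)"
    by (intro add_right_mono lsc_submeasure_Un[OF \<phi>(1)])
  finally have "(\<phi> {..<p} + \<phi> (A \<inter> {p..})) + \<phi> ({m..} - A) = \<infinity>"
    using \<phi>(2) by (simp add: top_unique)
  moreover have "\<phi> {..<p} < \<infinity>"
    using lsc_submeasure_finite[OF \<phi>(1)] by simp
  moreover have "\<phi> (A \<inter> {p..}) < \<infinity>"
    using p(2) less_trans by fastforce
  ultimately have "\<phi> ({m..} - A) = \<infinity>"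
    by (auto simp: ennreal_add_eq_top)
  moreover have "(\<lambda>n. \<phi> (({m..} - A) \<inter> {0..n})) \<longlonglongrightarrow> \<phi> ({m..} - A)"
    using \<phi>(1) by (simp add: lsc_submeasure_def)
  ultimately have "(\<lambda>n. \<phi> (({m..} - A) \<inter> {0..n})) \<longlonglongrightarrow> \<infinity>"
    by simp
  from order_tendstoD(1)[OF this, of 1] obtain n where "1 < \<phi> (({m..} - A) \<inter> {0..n})"
    by (auto simp: eventually_sequentially)
  also have "\<dots> \<le> \<phi> ({m..<Suc n} - A)"
    by (intro lsc_submeasure_mono[OF \<phi>(1)]) auto
  finally show ?thesis
    using less_imp_le by blast
qed

lemma bounded_if_staircases_controlled:
  assumes \<phi>: "lsc_submeasure \<phi>" "\<phi> UNIV = \<infinity>"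
    and B: "infinite B"
    and conv: "IQN_convergent_on (Exh \<phi>) F (\<lambda>n f. staircase f (enumerate B n)) (\<lambda>f. 0)"
  shows "\<not> unbounded_family F"
proof -
  obtain \<epsilon> :: "nat \<Rightarrow> real" where \<epsilon>: "I_convergent (Exh \<phi>) \<epsilon> 0" "\<And>n. \<epsilon> n > 0"
    and ctrl: "\<And>f. f \<in> F \<Longrightarrow> {n. \<bar>staircase f (enumerate B n) - 0\<bar> \<ge> \<epsilon> n} \<in> Exh \<phi>"
    using conv by (auto simp: IQN_convergent_on_def)
  have "{n. \<bar>\<epsilon> n - 0\<bar> \<ge> inverse (real (Suc k))} \<in> Exh \<phi>" for k
    using \<epsilon>(1) unfolding I_convergent_def
    by (metis inverse_positive_iff_positive of_nat_0_less_iff zero_less_Suc)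
  then have "\<exists>M. \<phi> ({k..<M} - {n. \<bar>\<epsilon> n - 0\<bar> \<ge> inverse (real (Suc k))}) \<ge> 1" for k
    by (intro unbounded_submeasure_diff_Exh[OF \<phi>])
  \<comment> \<open>\<open>G\<close> depends on \<open>\<epsilon>\<close> alone and not on a member
    of \<open>F\<close>, so it yields one bound for the whole family.\<close>
  then obtain G where G: "\<And>k. \<phi> ({k..<G k} - {n. \<bar>\<epsilon> n - 0\<bar> \<ge> inverse (real (Suc k))}) \<ge> 1"
    by metis
  have "\<forall>\<^sub>F k in sequentially. f k \<le> enumerate B (G k)" if "f \<in> F" for f
  proof -
    define A where "A = {n. \<bar>staircase f (enumerate B n) - 0\<bar> \<ge> \<epsilon> n}"
    have "\<forall>\<^sub>F k in sequentially. \<phi> (A \<inter> {k..}) < 1"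
      using ctrl[OF that] by (intro Exh_eventually_less) (auto simp: A_def)
    then show ?thesis
    proof eventually_elim
      case (elim k)
      show ?case
      proof (rule ccontr)
        assume "\<not> ?case"
        then have less: "enumerate B (G k) < f k"
          by simp
        \<comment> \<open>On this block \<open>\<epsilon> n < 1 / (k + 1)\<close>, while
          \<open>enumerate B n\<close> lies below \<open>f k\<close>, so the staircase is still at
          least \<open>1 / (k + 1)\<close>. A block of submeasure at least 1 would thus fit into a
          tail of \<open>A\<close> of submeasure below 1.\<close>
        have "{k..<G k} - {n. \<bar>\<epsilon> n - 0\<bar> \<ge> inverse (real (Suc k))} \<subseteq> A \<inter> {k..}"
        proof
          fix n assume n: "n \<in> {k..<G k} - {n. \<bar>\<epsilon> n - 0\<bar> \<ge> inverse (real (Suc k))}"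
          then have "enumerate B n < enumerate B (G k)"
            using enumerate_mono[OF _ B] by auto
          then have "inverse (real (Suc k)) \<le> staircase f (enumerate B n)"
            using less by (intro staircase_ge) simp
          with n show "n \<in> A \<inter> {k..}"
            by (auto simp: A_def)
        qed
        from lsc_submeasure_mono[OF \<phi>(1) this] G[of k] elim show False
          by (meson leD order_trans)
      qed
    qed
  qed
  then show ?thesis
    by (auto simp: unbounded_family_def intro!: exI[of _ "\<lambda>k. enumerate B (G k)"])
qed

lemma perfectly_normal_discrete: "perfectly_normal_space (discrete_topology U)"
  by (auto simp: perfectly_normal_space_def normal_space_discrete_topology
      intro: Hausdorff_imp_t1_space open_imp_gdelta_in)

lemma not_IwQN_space_of_size_bounding_number:
  assumes universe: "|UNIV :: (nat \<Rightarrow> nat) set| \<le>o |UNIV :: 'a set|"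
    and gen: "generated_by_unbounded_submeasure \<I>"
  obtains X :: "'a topology"
  where "perfectly_normal_space X" "\<not> IwQN_space \<I> X" "|topspace X| =o bounding_number"
proof -
  obtain \<phi> where \<phi>: "lsc_submeasure \<phi>" "\<phi> UNIV = \<infinity>" and \<I>: "\<I> = Exh \<phi>"
    using gen by (auto simp: generated_by_unbounded_submeasure_def)
  obtain F where F: "unbounded_family F" "bounding_number = |F|"
    by (rule bounding_number_attained)
  \<comment> \<open>The points of the space must lie in \<open>'a\<close>, so \<open>F\<close> is
    copied there by an injection; the discrete topology makes every function on the copy
    continuous.\<close>
  obtain c :: "(nat \<Rightarrow> nat) \<Rightarrow> 'a" where c: "inj c"
    using universe unfolding card_of_ordLeq[symmetric] by blast
  define f where "f n x = staircase (inv c x) n" for n x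
  have "continuous_null_sequence (discrete_topology (c ` F)) f"
    by (auto simp: continuous_null_sequence_def f_def staircase_tendsto_0)
  moreover have "\<not> IQN_convergent_on \<I> (c ` F) (\<lambda>n. f (enumerate B n)) (\<lambda>x. 0)"
    if "infinite B" for B
  proof
    assume "IQN_convergent_on \<I> (c ` F) (\<lambda>n. f (enumerate B n)) (\<lambda>x. 0)"
    then have "IQN_convergent_on (Exh \<phi>) F (\<lambda>n g. staircase g (enumerate B n)) (\<lambda>g. 0)"
      unfolding IQN_convergent_on_def \<I> f_def by (simp add: inv_f_f[OF c])
    with bounded_if_staircases_controlled[OF \<phi> that] F(1) show False
      by blast
  qed
  ultimately have "\<not> IwQN_space \<I> (discrete_topology (c ` F))"
    unfolding IwQN_space_def topspace_discrete_topology by blast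
  moreover have "|c ` F| =o bounding_number"
    unfolding F(2) using inj_on_subset[OF c]
    by (intro ordIso_symmetric[OF card_of_ordIsoI[of c]]) (simp add: bij_betw_def)
  ultimately show thesis
    by (intro that[OF perfectly_normal_discrete]) simp_all
qed

theorem corollary2p8:
  fixes \<I> :: "nat set set"
  assumes universe: "|UNIV :: (nat \<Rightarrow> nat) set| \<le>o |UNIV :: 'a set|"
    and "P_ideal \<I>"
    and "analytic_family \<I>"
    and "generated_by_unbounded_submeasure \<I>"
  shows "(non_IQN_space \<I> :: 'a rel) =o (non_IwQN_space \<I> :: 'a rel) \<and>
         (non_IwQN_space \<I> :: 'a rel) =o bounding_number"
proof -
  have ideal: "ideal_on_omega \<I>"
    using assms(2) by (simp add: P_ideal_def)
  obtain X :: "'a topology" where X: "perfectly_normal_space X" "\<not> IwQN_space \<I> X"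
    "|topspace X| =o bounding_number"
    using not_IwQN_space_of_size_bounding_number[OF universe assms(4)] .
  \<comment> \<open>One bound serves both invariants, since a space that is not
    \<open>IwQN_space\<close> is not \<open>IQN_space\<close> either. For the same reason
    \<open>X\<close> witnesses both minima.\<close>
  have lower: "bounding_number \<le>o |topspace Y|" if "\<not> IQN_space \<I> Y \<or> \<not> IwQN_space \<I> Y"
    for Y :: "'a topology"
    using that IQN_space_imp_IwQN_space bounding_number_le_not_IQN_space[OF ideal] by blast
  have "(non_IQN_space \<I> :: 'a rel) =o bounding_number"
    unfolding non_IQN_space_def
  proof (rule least_card_eqI[OF _ X(3)])
    show "topspace X \<in> {topspace X |X. perfectly_normal_space X \<and> \<not> IQN_space \<I> X}"
      using X(1,2) IQN_space_imp_IwQN_space by blast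
  qed (use lower in auto)
  moreover have "(non_IwQN_space \<I> :: 'a rel) =o bounding_number"
    unfolding non_IwQN_space_def
  proof (rule least_card_eqI[OF _ X(3)])
    show "topspace X \<in> {topspace X |X. perfectly_normal_space X \<and> \<not> IwQN_space \<I> X}"
      using X(1,2) by blast
  qed (use lower in auto)
  ultimately show ?thesis
    using ordIso_symmetric ordIso_transitive by blast
qed

end
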